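(* Let $P$ be a $\sigma$-program, $\kappa\ge k_P$, $n\ge 1$, and $\bar\ell=(\ell_1,\ell_2,\ldots)\in \mathrm{Lab}_P^{[\le\omega]}$. Then there is one sequence $\mathrm{seq}^{\mathrm{ind}}_{P,\bar\ell,\kappa,n}$ of partial $(P,\kappa)$-configurations in $\mathrm{Seq}^{\mathrm{ind}}_{P,\kappa,n}$ (with label sequence $\bar\ell$) such that $$\bigcup_{M}\mathrm{Con}^{\mathrm{ind}}_{M,\bar\ell,n}\subseteq\{\mathrm{seq}^{\mathrm{ind}}_{P,\bar\ell,\kappa,n}\},$$ where the union is over all structures $A$ and all BSS RAMs $M\in \mathsf M_A\cup \mathsf M_A^{\mathrm{DND}}\cup \mathsf M_A^{\mathrm{ND}}\cup \mathsf M_A^{\mathrm{NDB}}$ with $k_M=\kappa$ and $P_M=P$. Moreover, if the set on the left-hand side is not empty, then $\mathrm{seq}^{\mathrm{ind}}_{P,\bar\ell,\kappa,n}$ is a $(P,\kappa,n)$-path.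
   Context: **Programs.** $\mathbb N_+$ denotes the positive integers. Let $\sigma=(n_1;m_1,\ldots,m_{n_2};k_1,\ldots,k_{n_3})$ be a finite signature with constant symbols $c_i^0$, operation symbols $f_i^{m_i}$, relation symbols $r_i^{k_i}$. A $\sigma$-program $P$ is a list $1:\mathrm{instruction}_1;\ \ldots;\ \ell_P-1:\mathrm{instruction}_{\ell_P-1};\ \ell_P:\text{stop}$ with $\ell_P\ge1$, where each instruction with label $\ell<\ell_P$ has one of the forms: (1) $Z_j:=f_i^{m_i}(Z_{j_1},\ldots,Z_{j_{m_i}})$; (2) $Z_j:=c_i^0$; (3) $Z_{I_j}:=Z_{I_k}$; (4) if $r_i^{k_i}(Z_{j_1},\ldots,Z_{j_{k_i}})$ then goto $\ell_1'$ else goto $\ell_2'$; (5) if $I_j=I_k$ then goto $\ell_1'$ else goto $\ell_2'$; (6) $I_j:=1$; (7) $I_j:=I_j+1$; (11) goto $\ell_1'$ or goto $\ell_2'$; with $\ell_1',\ell_2'\in L_P=\{1,\ldots,\ell_P\}$. The index registers occurring in $P$ are among $I_1,\ldots,I_{k_P}$ ($k_P\ge 1$). Let $L_P^{\circ}=\{1,\ldots,\ell_P-1\}$, $L_P^{\mathrm B}$ = labels of instructions of types (4),(5),(11), $L_P^{\mathrm{NB}}=L_P^\circ\setminus L_P^{\mathrm B}$, $L_{P,\mathrm{H_T}}$ = labels of type (5), $L_{P,\mathrm H_1}$, $L_{P,\mathrm H_{+1}}$ = labels of types (6), (7). Put $\beta_P(\ell)=\ell+1$ for $\ell\in L_P^{\mathrm{NB}}$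 and, for $\ell\in L_P^{\mathrm B}$, $\beta_P^+(\ell)=\ell_1'$, $\beta_P^-(\ell)=\ell_2'$. **$P$-paths.** A finite $P$-path of length $s\ge1$ is $(\ell_1,\ldots,\ell_s)\in L_P^s$ with $\ell_1=1$, $\ell_s=\ell_P$, $\ell_t\in L_P^\circ$ for $t<s$, and for all $t<s$: $\ell_{t+1}=\beta_P(\ell_t)$ if $\ell_t\in L_P^{\mathrm{NB}}$, $\ell_{t+1}\in\{\beta_P^+(\ell_t),\beta_P^-(\ell_t)\}$ if $\ell_t\in L_P^{\mathrm B}$. An infinite $P$-path is $(\ell_1,\ell_2,\ldots)\in (L_P^\circ)^\omega$ with $\ell_1=1$ and the same successor rule for all $t\ge 1$. $\mathrm{Lab}_P$ is the set of all $P$-paths. $\mathrm{Lab}_P^{[\le\omega]}$ consists of all infinite $P$-paths and all sequences $(\ell_1,\ldots,\ell_s,\ell_s,\ell_s,\ldots)$ with $(\ell_1,\ldots,\ell_s)$ a finite $P$-path. **Partial configurations.** A partial $(P,\kappa)$-configuration is $(\ell\,.\,\vec\nu)$ with $\ell\in L_P$, $\vec\nu\in\mathbb N_+^\kappa$. For $\ell$ of type (6) (resp. (7)), $H_\ell^{(\kappa)}(\vec\nu)$ is obtained from $\vec\nu$ by replacing $\nu_j$ by $1$ (resp. $\nu_j+1$). For $\ell$ of type (5), $T_\ell^{(\kappa)}(\vec\nu)=\ell_1'$ if $\nu_j=\nu_k$ and $\ell_2'$ otherwise. $\mathrm{Seq}^{\mathrm{ind}}_{P,\kappa,n}$ is the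 set of sequences $(\ell_t\,.\,\vec\nu^{(t)})_{t\ge1}$ with $(\ell_t)_{t\ge1}\in\mathrm{Lab}_P^{[\le\omega]}$, $\vec\nu^{(1)}=(n,1,\ldots,1)\in\mathbb N_+^\kappa$, and for all $t\geq 1$, $\vec\nu^{(t+1)}=H_{\ell_t}^{(\kappa)}(\vec\nu^{(t)})$ if $\ell_t\in L_{P,\mathrm H_1}\cup L_{P,\mathrm H_{+1}}$ and $\vec\nu^{(t+1)}=\vec\nu^{(t)}$ otherwise. For given $\bar\ell$ there is exactly one element with label sequence $\bar\ell$; it is denoted $\mathrm{seq}^{\mathrm{ind}}_{P,\bar\ell,\kappa,n}$. A $(P,\kappa,n)$-path is an element of $\mathrm{Seq}^{\mathrm{ind}}_{P,\kappa,n}$ such that $\ell_{t+1}=T^{(\kappa)}_{\ell_t}(\vec\nu^{(t)})$ whenever $\ell_t\in L_{P,\mathrm{H_T}}$. **BSS RAMs.** Let $A$ be a $\sigma$-structure with universe $U_A$; $U_A^\infty=\bigcup_{n\ge1}U_A^n$. A BSS RAM $M$ over $A$ has a $\sigma$-program $P_M$ and $k_M\ge k_{P_M}$ index registers. Its configurations are $(\ell\,.\,\vec\nu\,.\,\bar u)$ with $\ell\in L_{P_M}$, $\vec\nu\in\mathbb N_+^{k_M}$, $\bar u\in U_A^\omega$ (contents of $I_1,\ldots,I_{k_M}$ and $Z_1,Z_2,\ldots$). The step relation $\to_M$ executes $\mathrm{instruction}_\ell$ in the obvious way: types (1),(2),(3) change one component of $\bar u$ (type (3): $u_{\nu_j}$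 becomes $u_{\nu_k}$), types (6),(7) change $\nu_j$, in all these cases going to label $\ell+1$; types (4),(5) only change the label, according to whether the condition holds ($\ell_1'$) or not ($\ell_2'$); type (11) only changes the label, to $\ell_1'$ or to $\ell_2'$ (both allowed); at $\ell=\ell_{P_M}$ the configuration is left unchanged. Initial configurations for input $\vec x\in U_A^n$: for $M\in\mathsf M_A$ and $M\in\mathsf M_A^{\mathrm{NDB}}$ it is $(1\,.\,(n,1,\ldots,1)\,.\,(x_1,\ldots,x_n,x_n,x_n,\ldots))$; for $M\in\mathsf M_A^{\mathrm{ND}}$ every $(1\,.\,(n,1,\ldots,1)\,.\,(x_1,\ldots,x_n,y_1,\ldots,y_m,x_n,x_n,\ldots))$ with $(y_1,\ldots,y_m)\in U_A^\infty$; for $M\in\mathsf M_A^{\mathrm{DND}}$ the same but with $(y_1,\ldots,y_m)\in\{c_1,c_2\}^\infty$ (here $A$ is assumed to contain two designated constants $c_1,c_2$). Type (11) is allowed only for $\mathsf M_A^{\mathrm{NDB}}$. $\mathrm{Con}_{M,n}$ is the set of all sequences $(con_t)_{t\ge1}$ of configurations such that $con_1$ is an initial configuration for some $\vec x\in U_A^n$ and $con_t\to_M con_{t+1}$ for all $t\geq 1$. For $\bar\ell=(\ell_t)_{t\ge1}$, $\mathrm{Con}^{\mathrm{ind}}_{M,\bar\ell,n}$ is the set of all $(\ell_t\,.\,\vec\mu^{(t)})_{t\ge1}$ for which there is $(\bar u^{(t)})_{t\ge1}\in(U_A^\omega)^\omega$ with $(\ell_t\,.\,\vec\mu^{(t)}\,.\,\bar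 u^{(t)})_{t\ge1}\in\mathrm{Con}_{M,n}$. *)

theory Defs
  imports Main "HOL-Library.FuncSet"
begin

text \<open>
  Registers, labels, symbols and time steps are numbered from 1.  An infinite sequence
  is an extensional function on \<open>{1..}\<close>, and a vector of index-register contents in
  \<open>N_+^k\<close> is an element of \<open>{1..k} \<rightarrow>\<^sub>E {1..}\<close>, so that
  equality of functions is equality of sequences.  Finite tuples are lists; the
  component \<open>x_i\<close> is \<open>xs ! (i - 1)\<close>.
\<close>

definition tuples :: "'a set \<Rightarrow> nat \<Rightarrow> 'a list set" where
  "tuples U n = {xs. set xs \<subseteq> U \<and> length xs = n}"

text \<open>The sequence \<open>(x_1, ..., x_s, a, a, a, ...)\<close>.\<close>

definition pad :: "'a list \<Rightarrow> 'a \<Rightarrow> nat \<Rightarrow> 'a" where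
  "pad xs a = (\<lambda>t\<in>{1..}. if t \<le> length xs then xs ! (t - 1) else a)"


section \<open>Signatures and structures\<close>

record signature =
  num_consts :: nat
  op_arities :: "nat list"
  rel_arities :: "nat list"

record 'a sig_structure =
  universe :: "'a set"
  const_of :: "nat \<Rightarrow> 'a"
  op_of :: "nat \<Rightarrow> 'a list \<Rightarrow> 'a"
  rel_of :: "nat \<Rightarrow> 'a list set"

definition is_structure :: "signature \<Rightarrow> 'a sig_structure \<Rightarrow> bool" where
  "is_structure \<sigma> A \<longleftrightarrow>
     universe A \<noteq> {} \<and>
     (\<forall>i\<in>{1..num_consts \<sigma>}. const_of A i \<in> universe A) \<and>
     (\<forall>i\<in>{1..length (op_arities \<sigma>)}.
        op_of A i \<in> tuples (universe A) (op_arities \<sigma> ! (i - 1)) \<rightarrow> universe A) \<and>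
     (\<forall>i\<in>{1..length (rel_arities \<sigma>)}.
        rel_of A i \<subseteq> tuples (universe A) (rel_arities \<sigma> ! (i - 1)))"


section \<open>Programs\<close>

datatype instruction =
    Op nat nat "nat list"              \<comment> \<open>\<open>Op j i [j_1, ..., j_m]\<close> is \<open>Z_j := f_i(Z_{j_1}, ..., Z_{j_m})\<close>\<close>
  | Const nat nat                      \<comment> \<open>\<open>Const j i\<close> is \<open>Z_j := c_i\<close>\<close>
  | Copy nat nat                       \<comment> \<open>\<open>Copy j k\<close> is \<open>Z_{I_j} := Z_{I_k}\<close>\<close>
  | is_RelTest: RelTest nat "nat list" nat nat     \<comment> \<open>\<open>RelTest i js l\<^sub>1 l\<^sub>2\<close>: goto \<open>l\<^sub>1\<close> if \<open>r_i\<close> holds, else \<open>l\<^sub>2\<close>\<close>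
  | is_IndTest: IndTest nat nat nat nat            \<comment> \<open>\<open>IndTest j k l\<^sub>1 l\<^sub>2\<close> tests \<open>I_j = I_k\<close> in the same way\<close>
  | is_IndOne: IndOne nat                         \<comment> \<open>\<open>I_j := 1\<close>\<close>
  | is_IndSuc: IndSuc nat                         \<comment> \<open>\<open>I_j := I_j + 1\<close>\<close>
  | is_Branch: Branch nat nat                     \<comment> \<open>\<open>goto l\<^sub>1 or goto l\<^sub>2\<close>\<close>

text \<open>A program lists the instructions with labels \<open>1, ..., \<ell>_P - 1\<close>; the final stop
  instruction with label \<open>\<ell>_P\<close> is implicit.\<close>

type_synonym program = "instruction list"

definition stop_label :: "program \<Rightarrow> nat" where
  "stop_label P = length P + 1"

definition instr :: "program \<Rightarrow> nat \<Rightarrow> instruction" where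
  "instr P l = P ! (l - 1)"

definition labels :: "program \<Rightarrow> nat set" where
  "labels P = {1..stop_label P}"

definition inner_labels :: "program \<Rightarrow> nat set" where
  "inner_labels P = {1..<stop_label P}"

fun wf_instruction :: "signature \<Rightarrow> nat set \<Rightarrow> instruction \<Rightarrow> bool" where
  "wf_instruction \<sigma> L (Op j i js) \<longleftrightarrow>
     1 \<le> j \<and> i \<in> {1..length (op_arities \<sigma>)} \<and> js \<in> tuples {1..} (op_arities \<sigma> ! (i - 1))"
| "wf_instruction \<sigma> L (Const j i) \<longleftrightarrow> 1 \<le> j \<and> i \<in> {1..num_consts \<sigma>}"
| "wf_instruction \<sigma> L (Copy j k) \<longleftrightarrow> 1 \<le> j \<and> 1 \<le> k"
| "wf_instruction \<sigma> L (RelTest i js l1 l2) \<longleftrightarrow>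
     i \<in> {1..length (rel_arities \<sigma>)} \<and> js \<in> tuples {1..} (rel_arities \<sigma> ! (i - 1)) \<and>
     l1 \<in> L \<and> l2 \<in> L"
| "wf_instruction \<sigma> L (IndTest j k l1 l2) \<longleftrightarrow> 1 \<le> j \<and> 1 \<le> k \<and> l1 \<in> L \<and> l2 \<in> L"
| "wf_instruction \<sigma> L (IndOne j) \<longleftrightarrow> 1 \<le> j"
| "wf_instruction \<sigma> L (IndSuc j) \<longleftrightarrow> 1 \<le> j"
| "wf_instruction \<sigma> L (Branch l1 l2) \<longleftrightarrow> l1 \<in> L \<and> l2 \<in> L"

definition is_program :: "signature \<Rightarrow> program \<Rightarrow> bool" where
  "is_program \<sigma> P \<longleftrightarrow> (\<forall>ins\<in>set P. wf_instruction \<sigma> (labels P) ins)"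

fun index_regs :: "instruction \<Rightarrow> nat set" where
  "index_regs (Copy j k) = {j, k}"
| "index_regs (IndTest j k l1 l2) = {j, k}"
| "index_regs (IndOne j) = {j}"
| "index_regs (IndSuc j) = {j}"
| "index_regs _ = {}"

text \<open>The number \<open>k_P\<close>: the least \<open>k \<ge> 1\<close> such that all index registers occurring in
  \<open>P\<close> are among \<open>I_1, ..., I_k\<close>.\<close>

definition num_index_regs :: "program \<Rightarrow> nat" where
  "num_index_regs P = Max (insert 1 (\<Union>ins\<in>set P. index_regs ins))"

definition HT_labels :: "program \<Rightarrow> nat set" where
  "HT_labels P = {l \<in> inner_labels P. is_IndTest (instr P l)}"

definition H1_labels :: "program \<Rightarrow> nat set" where
  "H1_labels P = {l \<in> inner_labels P. is_IndOne (instr P l)}"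

definition Hsuc_labels :: "program \<Rightarrow> nat set" where
  "Hsuc_labels P = {l \<in> inner_labels P. is_IndSuc (instr P l)}"

definition branching_labels :: "program \<Rightarrow> nat set" where
  "branching_labels P = {l \<in> inner_labels P.
     is_RelTest (instr P l) \<or> is_IndTest (instr P l) \<or> is_Branch (instr P l)}"

definition nonbranching_labels :: "program \<Rightarrow> nat set" where
  "nonbranching_labels P = inner_labels P - branching_labels P"

definition beta :: "program \<Rightarrow> nat \<Rightarrow> nat" where
  "beta P l = l + 1"

definition beta_plus :: "program \<Rightarrow> nat \<Rightarrow> nat" where
  "beta_plus P l = (case instr P l of
     RelTest i js l1 l2 \<Rightarrow> l1 | IndTest j k l1 l2 \<Rightarrow> l1 | Branch l1 l2 \<Rightarrow> l1 | _ \<Rightarrow> undefined)"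

definition beta_minus :: "program \<Rightarrow> nat \<Rightarrow> nat" where
  "beta_minus P l = (case instr P l of
     RelTest i js l1 l2 \<Rightarrow> l2 | IndTest j k l1 l2 \<Rightarrow> l2 | Branch l1 l2 \<Rightarrow> l2 | _ \<Rightarrow> undefined)"


section \<open>Paths through a program\<close>

definition path_succ :: "program \<Rightarrow> nat \<Rightarrow> nat \<Rightarrow> bool" where
  "path_succ P l l' \<longleftrightarrow>
     (l \<in> nonbranching_labels P \<longrightarrow> l' = beta P l) \<and>
     (l \<in> branching_labels P \<longrightarrow> l' \<in> {beta_plus P l, beta_minus P l})"

definition finite_paths :: "program \<Rightarrow> nat list set" where
  "finite_paths P = {ls. ls \<noteq> [] \<and> set ls \<subseteq> labels P \<and> hd ls = 1 \<and> last ls = stop_label P \<and>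
     set (butlast ls) \<subseteq> inner_labels P \<and>
     (\<forall>t. t + 1 < length ls \<longrightarrow> path_succ P (ls ! t) (ls ! (t + 1)))}"

definition infinite_paths :: "program \<Rightarrow> (nat \<Rightarrow> nat) set" where
  "infinite_paths P = {ls \<in> {1..} \<rightarrow>\<^sub>E inner_labels P. ls 1 = 1 \<and>
     (\<forall>t\<ge>1. path_succ P (ls t) (ls (t + 1)))}"

text \<open>The set \<open>Lab_P^{[\<le>\<omega>]}\<close>.\<close>

definition Lab_omega :: "program \<Rightarrow> (nat \<Rightarrow> nat) set" where
  "Lab_omega P = infinite_paths P \<union> {pad ls (last ls) | ls. ls \<in> finite_paths P}"


section \<open>Sequences of partial configurations\<close>

type_synonym partial_config = "nat \<times> (nat \<Rightarrow> nat)"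

definition index_vectors :: "nat \<Rightarrow> (nat \<Rightarrow> nat) set" where
  "index_vectors \<kappa> = {1..\<kappa>} \<rightarrow>\<^sub>E {1..}"

definition partial_configs :: "program \<Rightarrow> nat \<Rightarrow> partial_config set" where
  "partial_configs P \<kappa> = labels P \<times> index_vectors \<kappa>"

definition init_index :: "nat \<Rightarrow> nat \<Rightarrow> nat \<Rightarrow> nat" where
  "init_index \<kappa> n = (\<lambda>j\<in>{1..\<kappa>}. if j = 1 then n else 1)"

text \<open>The functions \<open>H_\<ell>\<close> and \<open>T_\<ell>\<close> are only used for labels of assignments to an index
  register and of index tests, respectively.\<close>

definition H_fun :: "program \<Rightarrow> nat \<Rightarrow> (nat \<Rightarrow> nat) \<Rightarrow> nat \<Rightarrow> nat" where
  "H_fun P l \<nu> = (case instr P l of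
     IndOne j \<Rightarrow> \<nu>(j := 1) | IndSuc j \<Rightarrow> \<nu>(j := \<nu> j + 1) | _ \<Rightarrow> undefined)"

definition T_fun :: "program \<Rightarrow> nat \<Rightarrow> (nat \<Rightarrow> nat) \<Rightarrow> nat" where
  "T_fun P l \<nu> = (case instr P l of
     IndTest j k l1 l2 \<Rightarrow> (if \<nu> j = \<nu> k then l1 else l2) | _ \<Rightarrow> undefined)"

definition label_seq :: "(nat \<Rightarrow> partial_config) \<Rightarrow> nat \<Rightarrow> nat" where
  "label_seq s = (\<lambda>t\<in>{1..}. fst (s t))"

definition Seq_ind :: "program \<Rightarrow> nat \<Rightarrow> nat \<Rightarrow> (nat \<Rightarrow> partial_config) set" where
  "Seq_ind P \<kappa> n = {s \<in> {1..} \<rightarrow>\<^sub>E partial_configs P \<kappa>.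
     label_seq s \<in> Lab_omega P \<and> snd (s 1) = init_index \<kappa> n \<and>
     (\<forall>t\<ge>1. snd (s (t + 1)) =
        (if fst (s t) \<in> H1_labels P \<union> Hsuc_labels P then H_fun P (fst (s t)) (snd (s t))
         else snd (s t)))}"

definition seq_ind :: "program \<Rightarrow> (nat \<Rightarrow> nat) \<Rightarrow> nat \<Rightarrow> nat \<Rightarrow> nat \<Rightarrow> partial_config" where
  "seq_ind P ls \<kappa> n = (THE s. s \<in> Seq_ind P \<kappa> n \<and> label_seq s = ls)"

text \<open>The \<open>(P, \<kappa>, n)\<close>-paths.\<close>

definition index_paths :: "program \<Rightarrow> nat \<Rightarrow> nat \<Rightarrow> (nat \<Rightarrow> partial_config) set" where
  "index_paths P \<kappa> n = {s \<in> Seq_ind P \<kappa> n.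
     \<forall>t\<ge>1. fst (s t) \<in> HT_labels P \<longrightarrow> fst (s (t + 1)) = T_fun P (fst (s t)) (snd (s t))}"


section \<open>BSS RAMs\<close>

text \<open>\<open>DND i j\<close> marks a digitally nondeterministic machine whose two designated constants
  are the values of the constant symbols with numbers \<open>i\<close> and \<open>j\<close>.\<close>

datatype ram_kind = Det | DND nat nat | ND | NDB

record 'a bss_ram =
  ram_structure :: "'a sig_structure"
  ram_kind :: ram_kind
  ram_program :: program
  ram_index_regs :: nat

definition ram_over :: "signature \<Rightarrow> 'a sig_structure \<Rightarrow> 'a bss_ram \<Rightarrow> bool" where
  "ram_over \<sigma> A M \<longleftrightarrow> ram_structure M = A \<and> is_program \<sigma> (ram_program M) \<and>
     ram_index_regs M \<ge> num_index_regs (ram_program M)"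

definition branch_free :: "program \<Rightarrow> bool" where
  "branch_free P \<longleftrightarrow> (\<forall>ins\<in>set P. \<not> is_Branch ins)"

definition M_Det :: "signature \<Rightarrow> 'a sig_structure \<Rightarrow> 'a bss_ram set" where
  "M_Det \<sigma> A = {M. ram_over \<sigma> A M \<and> branch_free (ram_program M) \<and> ram_kind M = Det}"

definition M_DND :: "signature \<Rightarrow> 'a sig_structure \<Rightarrow> 'a bss_ram set" where
  "M_DND \<sigma> A = {M. ram_over \<sigma> A M \<and> branch_free (ram_program M) \<and>
     (\<exists>i\<in>{1..num_consts \<sigma>}. \<exists>j\<in>{1..num_consts \<sigma>}. i \<noteq> j \<and> ram_kind M = DND i j)}"

definition M_ND :: "signature \<Rightarrow> 'a sig_structure \<Rightarrow> 'a bss_ram set" where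
  "M_ND \<sigma> A = {M. ram_over \<sigma> A M \<and> branch_free (ram_program M) \<and> ram_kind M = ND}"

definition M_NDB :: "signature \<Rightarrow> 'a sig_structure \<Rightarrow> 'a bss_ram set" where
  "M_NDB \<sigma> A = {M. ram_over \<sigma> A M \<and> ram_kind M = NDB}"

type_synonym 'a config = "nat \<times> (nat \<Rightarrow> nat) \<times> (nat \<Rightarrow> 'a)"

definition configs :: "'a bss_ram \<Rightarrow> 'a config set" where
  "configs M = labels (ram_program M) \<times> index_vectors (ram_index_regs M) \<times>
     ({1..} \<rightarrow>\<^sub>E universe (ram_structure M))"

inductive ram_step :: "'a bss_ram \<Rightarrow> 'a config \<Rightarrow> 'a config \<Rightarrow> bool" for M where
  op: "l \<in> inner_labels (ram_program M) \<Longrightarrow> instr (ram_program M) l = Op j i js \<Longrightarrow>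
     ram_step M (l, \<nu>, u) (l + 1, \<nu>, u(j := op_of (ram_structure M) i (map u js)))"
| const: "l \<in> inner_labels (ram_program M) \<Longrightarrow> instr (ram_program M) l = Const j i \<Longrightarrow>
     ram_step M (l, \<nu>, u) (l + 1, \<nu>, u(j := const_of (ram_structure M) i))"
| copy: "l \<in> inner_labels (ram_program M) \<Longrightarrow> instr (ram_program M) l = Copy j k \<Longrightarrow>
     ram_step M (l, \<nu>, u) (l + 1, \<nu>, u(\<nu> j := u (\<nu> k)))"
| rel_test: "l \<in> inner_labels (ram_program M) \<Longrightarrow>
     instr (ram_program M) l = RelTest i js l1 l2 \<Longrightarrow>
     ram_step M (l, \<nu>, u) (if map u js \<in> rel_of (ram_structure M) i then l1 else l2, \<nu>, u)"
| ind_test: "l \<in> inner_labels (ram_program M) \<Longrightarrow>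
     instr (ram_program M) l = IndTest j k l1 l2 \<Longrightarrow>
     ram_step M (l, \<nu>, u) (if \<nu> j = \<nu> k then l1 else l2, \<nu>, u)"
| ind_one: "l \<in> inner_labels (ram_program M) \<Longrightarrow> instr (ram_program M) l = IndOne j \<Longrightarrow>
     ram_step M (l, \<nu>, u) (l + 1, \<nu>(j := 1), u)"
| ind_suc: "l \<in> inner_labels (ram_program M) \<Longrightarrow> instr (ram_program M) l = IndSuc j \<Longrightarrow>
     ram_step M (l, \<nu>, u) (l + 1, \<nu>(j := \<nu> j + 1), u)"
| branch: "l \<in> inner_labels (ram_program M) \<Longrightarrow> instr (ram_program M) l = Branch l1 l2 \<Longrightarrow>
     l' \<in> {l1, l2} \<Longrightarrow> ram_step M (l, \<nu>, u) (l', \<nu>, u)"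
| stop: "l = stop_label (ram_program M) \<Longrightarrow> ram_step M (l, \<nu>, u) (l, \<nu>, u)"

text \<open>The tuples that may follow the input \<open>xs\<close> in the \<open>Z\<close>-registers: none for the
  deterministic and the branching machines, otherwise a guess of length at least 1.\<close>

definition guesses :: "'a bss_ram \<Rightarrow> 'a list set" where
  "guesses M = (case ram_kind M of
     Det \<Rightarrow> {[]}
   | NDB \<Rightarrow> {[]}
   | ND \<Rightarrow> (\<Union>m\<in>{1..}. tuples (universe (ram_structure M)) m)
   | DND i j \<Rightarrow>
      (\<Union>m\<in>{1..}. tuples {const_of (ram_structure M) i, const_of (ram_structure M) j} m))"

definition initial_configs :: "'a bss_ram \<Rightarrow> 'a list \<Rightarrow> 'a config set" where
  "initial_configs M xs =
     {(1, init_index (ram_index_regs M) (length xs), pad (xs @ ys) (last xs)) | ys.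
       ys \<in> guesses M}"

definition Con :: "'a bss_ram \<Rightarrow> nat \<Rightarrow> (nat \<Rightarrow> 'a config) set" where
  "Con M n = {con \<in> {1..} \<rightarrow>\<^sub>E configs M.
     (\<exists>xs\<in>tuples (universe (ram_structure M)) n. con 1 \<in> initial_configs M xs) \<and>
     (\<forall>t\<ge>1. ram_step M (con t) (con (t + 1)))}"

definition Con_ind :: "'a bss_ram \<Rightarrow> (nat \<Rightarrow> nat) \<Rightarrow> nat \<Rightarrow> (nat \<Rightarrow> partial_config) set" where
  "Con_ind M ls n = {(\<lambda>t\<in>{1..}. (ls t, \<mu> t)) | \<mu>.
     \<exists>u. (\<lambda>t\<in>{1..}. (ls t, \<mu> t, u t)) \<in> Con M n}"

text \<open>The union of the sets \<open>Con^{ind}_{M,ls,n}\<close> over all structures \<open>A\<close> with universe in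
  the type \<^typ>\<open>'a\<close> and all machines over \<open>A\<close> with program \<open>P\<close> and \<open>\<kappa>\<close> index
  registers.  HOL has no union over all types; \<^const>\<open>seq_ind\<close> does not depend on
  \<^typ>\<open>'a\<close>, so a statement with \<^typ>\<open>'a\<close> arbitrary covers all structures.\<close>

definition all_Con_ind ::
  "'a itself \<Rightarrow> signature \<Rightarrow> program \<Rightarrow> (nat \<Rightarrow> nat) \<Rightarrow> nat \<Rightarrow> nat \<Rightarrow> (nat \<Rightarrow> partial_config) set"
where
  "all_Con_ind _ \<sigma> P ls \<kappa> n = \<Union> {Con_ind M ls n | (A :: 'a sig_structure) M.
     is_structure \<sigma> A \<and> M \<in> M_Det \<sigma> A \<union> M_DND \<sigma> A \<union> M_ND \<sigma> A \<union> M_NDB \<sigma> A \<and>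
     ram_index_regs M = \<kappa> \<and> ram_program M = P}"

end

theory Submission imports Defs begin

text \<open>Index registers never depend on the contents of the Z-registers: each instruction
  changes them in a way fixed by its label and their present values. This update is
  \<open>index_update\<close>. Since they start from \<open>init_index \<kappa> n\<close>, a
  prescribed label sequence determines all later index vectors by recursion
  (\<open>Seq_ind_exists\<close>, \<open>Seq_ind_unique\<close>). Neither the structure, the guess
  nor the kind of machine enters, so forgetting the Z-registers of any run with labels
  \<open>ls\<close> leaves that one sequence (\<open>Con_ind_index_path\<close>). An index test
  reads index registers only, so a single run with these labels already shows that the sequence
  obeys every index test it passes.\<close>

definition index_update :: "program \<Rightarrow> nat \<Rightarrow> (nat \<Rightarrow> nat) \<Rightarrow> nat \<Rightarrow> nat" where
  "index_update P l \<nu> = (if l \<in> H1_labels P \<union> Hsuc_labels P then H_fun P l \<nu> else \<nu>)"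

lemma Lab_omega_PiE:
  assumes "ls \<in> Lab_omega P"
  shows "ls \<in> {1..} \<rightarrow>\<^sub>E labels P"
proof (cases "ls \<in> infinite_paths P")
  case True
  then have "ls \<in> {1..} \<rightarrow>\<^sub>E inner_labels P"
    by (simp add: infinite_paths_def)
  moreover have "inner_labels P \<subseteq> labels P"
    by (auto simp: inner_labels_def labels_def)
  ultimately show ?thesis
    by (auto simp: PiE_iff)
next
  case False
  then obtain xs where xs: "xs \<in> finite_paths P" and ls: "ls = pad xs (last xs)"
    using assms by (auto simp: Lab_omega_def)
  from xs have "xs \<noteq> []" "set xs \<subseteq> labels P"
    by (auto simp: finite_paths_def)
  then show ?thesis
    unfolding ls pad_def by (auto intro!: subsetD[OF \<open>set xs \<subseteq> labels P\<close>] nth_mem)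
qed

lemma init_index_in_index_vectors: "n \<ge> 1 \<Longrightarrow> init_index \<kappa> n \<in> index_vectors \<kappa>"
  by (auto simp: init_index_def index_vectors_def)

lemma index_regs_le_num_index_regs:
  assumes "ins \<in> set P" and "j \<in> index_regs ins"
  shows "j \<le> num_index_regs P"
proof -
  have "finite (index_regs i)" for i
    by (cases i) auto
  then show ?thesis
    unfolding num_index_regs_def using assms by (intro Max_ge) auto
qed

lemma instr_in_set: "l \<in> inner_labels P \<Longrightarrow> instr P l \<in> set P"
  by (auto simp: inner_labels_def stop_label_def instr_def)

text \<open>The bound on \<open>\<kappa>\<close> and well-formedness of \<open>P\<close> put the
  assigned register in \<open>{1..\<kappa>}\<close>, so a function update at it keeps the vector
  extensional.\<close>

lemma index_update_in_index_vectors: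
  assumes P: "is_program \<sigma> P" and \<kappa>: "num_index_regs P \<le> \<kappa>"
    and \<nu>: "\<nu> \<in> index_vectors \<kappa>"
  shows "index_update P l \<nu> \<in> index_vectors \<kappa>"
proof (cases "l \<in> H1_labels P \<union> Hsuc_labels P")
  case True
  then have mem: "instr P l \<in> set P"
    by (auto simp: H1_labels_def Hsuc_labels_def intro: instr_in_set)
  from True obtain j where j: "instr P l = IndOne j \<or> instr P l = IndSuc j"
    by (auto simp: H1_labels_def Hsuc_labels_def is_IndOne_def is_IndSuc_def)
  have "j \<le> \<kappa>"
    using index_regs_le_num_index_regs[OF mem, of j] j \<kappa> by auto
  moreover have "1 \<le> j"
    using P mem j by (force simp: is_program_def)
  ultimately show ?thesis
    using True j \<nu> by (auto simp: index_update_def H_fun_def index_vectors_def PiE_iff extensional_def)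
qed (use \<nu> in \<open>simp add: index_update_def\<close>)

lemma Seq_ind_iff:
  "s \<in> Seq_ind P \<kappa> n \<longleftrightarrow>
     s \<in> {1..} \<rightarrow>\<^sub>E partial_configs P \<kappa> \<and> label_seq s \<in> Lab_omega P \<and>
     snd (s 1) = init_index \<kappa> n \<and>
     (\<forall>t\<ge>1. snd (s (t + 1)) = index_update P (fst (s t)) (snd (s t)))"
  by (simp add: Seq_ind_def index_update_def)

lemma Seq_ind_unique:
  assumes s: "s \<in> Seq_ind P \<kappa> n" and s': "s' \<in> Seq_ind P \<kappa> n"
    and eq: "label_seq s = label_seq s'"
  shows "s = s'"
proof
  have lab: "fst (s t) = fst (s' t)" if "t \<ge> 1" for t
    using fun_cong[OF eq, of t] that by (simp add: label_seq_def)
  have idx: "snd (s t) = snd (s' t)" if "t \<ge> 1" for t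
    using that
  proof (induction t rule: nat_induct_at_least)
    case base
    then show ?case using s s' by (simp add: Seq_ind_iff)
  next
    case (Suc t)
    then show ?case using s s' lab[of t] by (simp add: Seq_ind_iff)
  qed
  fix t
  show "s t = s' t"
  proof (cases "t \<ge> 1")
    case True
    then show ?thesis using lab idx by (simp add: prod_eq_iff)
  next
    case False
    \<comment> \<open>Time \<open>0\<close> lies outside the domain, where extensionality makes both
      sequences \<open>undefined\<close>.\<close>
    then show ?thesis using s s' by (auto simp: Seq_ind_iff PiE_iff extensional_def)
  qed
qed

text \<open>Starts at time \<open>1\<close>; the value at \<open>0\<close> is irrelevant.\<close>

fun index_contents :: "program \<Rightarrow> (nat \<Rightarrow> nat) \<Rightarrow> nat \<Rightarrow> nat \<Rightarrow> nat \<Rightarrow> nat \<Rightarrow> nat" where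
  "index_contents P ls \<kappa> n 0 = init_index \<kappa> n"
| "index_contents P ls \<kappa> n (Suc 0) = init_index \<kappa> n"
| "index_contents P ls \<kappa> n (Suc (Suc t)) =
     index_update P (ls (Suc t)) (index_contents P ls \<kappa> n (Suc t))"

lemma index_contents_in_index_vectors:
  assumes "is_program \<sigma> P" and "num_index_regs P \<le> \<kappa>" and "n \<ge> 1"
  shows "index_contents P ls \<kappa> n t \<in> index_vectors \<kappa>"
  using assms
  by (induction P ls \<kappa> n t rule: index_contents.induct)
    (auto intro: init_index_in_index_vectors index_update_in_index_vectors)

lemma label_seq_pair:
  assumes "ls \<in> extensional {1..}"
  shows "label_seq (\<lambda>t\<in>{1..}. (ls t, \<mu> t)) = ls"
  using assms by (auto simp: label_seq_def extensional_def fun_eq_iff)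

lemma Seq_ind_exists:
  assumes "is_program \<sigma> P" and "num_index_regs P \<le> \<kappa>" and "n \<ge> 1" and ls: "ls \<in> Lab_omega P"
  shows "\<exists>s \<in> Seq_ind P \<kappa> n. label_seq s = ls"
proof
  let ?s = "\<lambda>t\<in>{1..}. (ls t, index_contents P ls \<kappa> n t)"
  note ls_PiE = Lab_omega_PiE[OF ls]
  show lab: "label_seq ?s = ls"
    using ls_PiE by (intro label_seq_pair) (simp add: PiE_iff)
  have "snd (?s (t + 1)) = index_update P (fst (?s t)) (snd (?s t))" if "t \<ge> 1" for t
    \<comment> \<open>Writing \<open>t\<close> as a successor lets the third equation of
      \<open>index_contents\<close> apply.\<close>
    using that by (cases t) auto
  moreover have "?s \<in> {1..} \<rightarrow>\<^sub>E partial_configs P \<kappa>"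
    using ls_PiE index_contents_in_index_vectors[OF assms(1-3)]
    by (auto simp: partial_configs_def PiE_iff)
  ultimately show "?s \<in> Seq_ind P \<kappa> n"
    using lab ls by (simp add: Seq_ind_iff)
qed

text \<open>The stop label is not an inner label, so there \<open>index_update\<close> is the
  identity, as a halted machine requires.\<close>

lemma ram_step_index_update:
  assumes "ram_step M (l, \<nu>, u) (l', \<nu>', u')"
  shows "\<nu>' = index_update (ram_program M) l \<nu>"
  using assms
  by cases (auto simp: index_update_def H1_labels_def Hsuc_labels_def H_fun_def inner_labels_def)

lemma ram_step_index_test:
  assumes "ram_step M (l, \<nu>, u) (l', \<nu>', u')" and "l \<in> HT_labels (ram_program M)"
  shows "l' = T_fun (ram_program M) l \<nu>"
  using assms by cases (auto simp: HT_labels_def T_fun_def inner_labels_def)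

text \<open>The hypothesis on \<open>ls\<close> supplies the path property of the labels; the run
  only has to supply the start vector, the updates and the outcomes of index tests.\<close>

lemma Con_ind_index_path:
  assumes s: "s \<in> Con_ind M ls n" and ls: "ls \<in> Lab_omega (ram_program M)"
  shows "s \<in> index_paths (ram_program M) (ram_index_regs M) n \<and> label_seq s = ls"
proof -
  obtain \<mu> u where s_eq: "s = (\<lambda>t\<in>{1..}. (ls t, \<mu> t))"
    and con: "(\<lambda>t\<in>{1..}. (ls t, \<mu> t, u t)) \<in> Con M n"
    using s by (auto simp: Con_ind_def)
  have lab: "label_seq s = ls"
    unfolding s_eq using Lab_omega_PiE[OF ls] by (intro label_seq_pair) (simp add: PiE_iff)
  have step: "ram_step M (ls t, \<mu> t, u t) (ls (t + 1), \<mu> (t + 1), u (t + 1))" if "t \<ge> 1" for t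
    using con that by (auto simp: Con_def)
  \<comment> \<open>Guesses affect only the Z-registers, so all kinds of machine start with the same
    index vector, built from the input length \<open>n\<close>.\<close>
  have init: "\<mu> 1 = init_index (ram_index_regs M) n"
    using con by (auto simp: Con_def initial_configs_def tuples_def)
  have "s \<in> {1..} \<rightarrow>\<^sub>E partial_configs (ram_program M) (ram_index_regs M)"
    using con by (auto simp: s_eq Con_def configs_def partial_configs_def PiE_iff)
  then have "s \<in> Seq_ind (ram_program M) (ram_index_regs M) n"
    using lab ls init ram_step_index_update[OF step] by (simp add: Seq_ind_iff s_eq)
  then show ?thesis
    using lab ram_step_index_test[OF step] by (simp add: index_paths_def s_eq)
qed

theorem theorem3p11:
  fixes \<sigma> :: signature and P :: program and \<kappa> n :: nat and ls :: "nat \<Rightarrow> nat"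
  assumes "is_program \<sigma> P"
    and "\<kappa> \<ge> num_index_regs P"
    and "n \<ge> 1"
    and "ls \<in> Lab_omega P"
  shows "(\<exists>!s. s \<in> Seq_ind P \<kappa> n \<and> label_seq s = ls) \<and>
    seq_ind P ls \<kappa> n \<in> Seq_ind P \<kappa> n \<and> label_seq (seq_ind P ls \<kappa> n) = ls \<and>
    all_Con_ind TYPE('a) \<sigma> P ls \<kappa> n \<subseteq> {seq_ind P ls \<kappa> n} \<and>
    (all_Con_ind TYPE('a) \<sigma> P ls \<kappa> n \<noteq> {} \<longrightarrow> seq_ind P ls \<kappa> n \<in> index_paths P \<kappa> n)"
proof -
  have ex1: "\<exists>!s. s \<in> Seq_ind P \<kappa> n \<and> label_seq s = ls"
    using Seq_ind_exists[OF assms] Seq_ind_unique by blast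
  have seq: "seq_ind P ls \<kappa> n \<in> Seq_ind P \<kappa> n \<and> label_seq (seq_ind P ls \<kappa> n) = ls"
    unfolding seq_ind_def by (rule theI'[OF ex1])
  \<comment> \<open>One fact serves both claims: every member of the union equals
    \<open>seq_ind\<close>, and if a member exists, its path property passes to
    \<open>seq_ind\<close>.\<close>
  have path: "s \<in> index_paths P \<kappa> n \<and> s = seq_ind P ls \<kappa> n"
    if s: "s \<in> all_Con_ind TYPE('a) \<sigma> P ls \<kappa> n" for s
  proof -
    obtain M :: "'a bss_ram"
      where "s \<in> Con_ind M ls n" "ram_index_regs M = \<kappa>" "ram_program M = P"
      using s by (auto simp: all_Con_ind_def)
    then have "s \<in> index_paths P \<kappa> n" "label_seq s = ls"
      using Con_ind_index_path[of s M ls n] assms(4) by auto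
    then show ?thesis
      using ex1 seq by (auto simp: index_paths_def)
  qed
  show ?thesis
    using ex1 seq path by blast
qed

end
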